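(* Let $G:\mathbb{R}_+\times\mathcal{S}\to\mathbb{R}_+$ satisfy Assumption (A) of the context, and suppose that $P(a_t|s_t)$, for all $t$, $a_t$, $s_t$, is an optimal solution of the generalized maximum causal entropy problem $$\max_{P(a_t|s_t),\ \forall a_t,s_t}\ H^G(\mathbf{A}\|\mathbf{S})\quad\text{subject to}\quad \mathbb{E}_{\mathbf{S},\mathbf{A}}[R(\mathbf{S},\mathbf{A})]=\widetilde{\mathbb{E}}_{\mathbf{S},\mathbf{A}}[R(\mathbf{S},\mathbf{A})],\qquad \sum_{a_t\in\mathcal{A}^t}P(a_t|s_t)=1\ \ \forall t,\,s_t .$$ Then these probabilities can be computed by the following recursive equations: $$Y_{a_t|s_t}=\lambda R(s_t,a_t)+\mathbb{E}_{s_{t+1}}\big[\ln G(Z_{s_{t+1}}|s_{t+1})\big],$$ $$Z_{a_t|s_t}=G^{-1}\big(e^{Y_{a_t|s_t}}\,\big|\,s_t\big),\qquad Z_{s_t}=\sum_{a_t\in\mathcal{A}^t}Z_{a_t|s_t},$$ $$P(a_t|s_t)=\frac{Z_{a_t|s_t}}{Z_{s_t}}\qquad\text{for all } t,\ a_t,\ s_t,$$ where $\lambda$ is a scalar that depends on the empirical expectation of the reward $\widetilde{\mathbb{E}}_{\mathbf{S},\mathbf{A}}[R(\mathbf{S},\mathbf{A})]$, the expectation $\mathbb{E}_{s_{t+1}}$ is taken over $s_{t+1}\sim p(\cdot|a_t,s_t)$, and at the last time step $t=T-1$ the expectation term is $0$.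
   Context: Setting: a finite-horizon undiscounted Markov decision process with finite state set $\mathcal{S}$, finite action set $\mathcal{A}$, transition probabilities $p(s'|a,s)$, real-valued reward $R(s,a)$, horizon $T\ge 1$, a given distribution of the initial state $s_0$, and for each time $t\in\{0,\dots,T-1\}$ a set $\mathcal{A}^t\subseteq\mathcal{A}$ of possible actions. Here $\mathbb{R}_+=(0,\infty)$. The variables are the action probabilities $P(a_t|s_t)$, $t\in\{0,\dots,T-1\}$, $s_t\in\mathcal{S}$, $a_t\in\mathcal{A}^t$ (their values may depend on $t$). Together with the initial distribution and $p$, they determine the law of the random sequences $\mathbf{S}=(s_0,\dots,s_{T-1})$, $\mathbf{A}=(a_0,\dots,a_{T-1})$: $a_t$ is drawn from $P(\cdot|s_t)$ and $s_{t+1}$ from $p(\cdot|a_t,s_t)$. Expectations $\mathbb{E}_{\mathbf{S},\mathbf{A}}$ are under this law. Put $R(\mathbf{S},\mathbf{A})=\sum_{t=0}^{T-1}R(s_t,a_t)$. The number $\widetilde{\mathbb{E}}_{\mathbf{S},\mathbf{A}}[R(\mathbf{S},\mathbf{A})]$ is a given constant, the empirical expectation of the accumulated reward over demonstrated trajectories. The generalized causal entropy is $$H^G(\mathbf{A}\|\mathbf{S})=\mathbb{E}_{\mathbf{A},\mathbf{S}}\Big[-\sum_{t=0}^{T-1}\ln G(P(a_t|s_t)|s_t)\Big].$$ Assumption (A): for any $p\in\mathbb{R}_+$ and $s\in\mathcal{S}$, (i) $G(p|s)$ and $\partial G(p|s)/\partial p$ both exist and are positive; (ii) $G(p|s)$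 is invertible, i.e. there exists a unique function $G^{-1}(h|s):\mathbb{R}_+\times\mathcal{S}\to\mathbb{R}_+$ such that $G^{-1}(G(p|s)|s)=p$ for all $p\in\mathbb{R}_+$; (iii) there exists a mapping $\mu:\mathcal{S}\to\mathbb{R}_+$ such that $\partial \ln G(p|s)/\partial p=\mu(s)/p$.
   Formalization: The formal theorem assumes in addition that G(1|s) is the same for all states s, and asserts the formula for P(a_t|s_t) only at states s_t having positive probability at time t; the claim as written fails without either. Probabilities P(a_t|s_t) are taken to be positive. *)

theory Defs
  imports "HOL-Probability.Probability"
begin

text \<open>
  States and actions are finite types. A policy assigns to each time and state a distribution of
  the action; the decision variable $P(a_t \mid s_t)$ is \<open>pmf (P t s) a\<close>. Only times \<open>t < T\<close> matter.
\<close>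

type_synonym ('s, 'a) policy = "nat \<Rightarrow> 's \<Rightarrow> 'a pmf"

text \<open>The next \<open>n\<close> state-action pairs when the process is in state \<open>s\<close> at time \<open>t\<close>.
  The state reached after the last action is drawn and discarded.\<close>

primrec rollout ::
  "('a \<Rightarrow> 's \<Rightarrow> 's pmf) \<Rightarrow> ('s, 'a) policy \<Rightarrow> nat \<Rightarrow> nat \<Rightarrow> 's \<Rightarrow> ('s \<times> 'a) list pmf" where
  "rollout p P 0 t s = return_pmf []"
| "rollout p P (Suc n) t s =
     bind_pmf (P t s) (\<lambda>a. bind_pmf (p a s) (\<lambda>s'.
       map_pmf (\<lambda>w. (s, a) # w) (rollout p P n (Suc t) s')))"

definition trajectory_law ::
  "'s pmf \<Rightarrow> ('a \<Rightarrow> 's \<Rightarrow> 's pmf) \<Rightarrow> nat \<Rightarrow> ('s, 'a) policy \<Rightarrow> ('s \<times> 'a) list pmf" where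
  "trajectory_law p0 p T P = bind_pmf p0 (rollout p P T 0)"

abbreviation state_at :: "('s \<times> 'a) list \<Rightarrow> nat \<Rightarrow> 's" where
  "state_at w t \<equiv> fst (w ! t)"

abbreviation action_at :: "('s \<times> 'a) list \<Rightarrow> nat \<Rightarrow> 'a" where
  "action_at w t \<equiv> snd (w ! t)"

definition expected_reward ::
  "'s pmf \<Rightarrow> ('a \<Rightarrow> 's \<Rightarrow> 's pmf) \<Rightarrow> ('s \<Rightarrow> 'a \<Rightarrow> real) \<Rightarrow> nat \<Rightarrow> ('s, 'a) policy \<Rightarrow> real" where
  "expected_reward p0 p R T P =
     measure_pmf.expectation (trajectory_law p0 p T P)
       (\<lambda>w. \<Sum>t<T. R (state_at w t) (action_at w t))"

definition gen_causal_entropy ::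
  "(real \<Rightarrow> 's \<Rightarrow> real) \<Rightarrow> 's pmf \<Rightarrow> ('a \<Rightarrow> 's \<Rightarrow> 's pmf) \<Rightarrow> nat \<Rightarrow> ('s, 'a) policy \<Rightarrow> real" where
  "gen_causal_entropy G p0 p T P =
     measure_pmf.expectation (trajectory_law p0 p T P)
       (\<lambda>w. - (\<Sum>t<T. ln (G (pmf (P t (state_at w t)) (action_at w t)) (state_at w t))))"

text \<open>
  The variables range over the positive reals because \<open>G (\<cdot>) s\<close> is a function on the positive reals.
\<close>

definition gmce_feasible ::
  "'s pmf \<Rightarrow> ('a \<Rightarrow> 's \<Rightarrow> 's pmf) \<Rightarrow> ('s \<Rightarrow> 'a \<Rightarrow> real) \<Rightarrow> nat \<Rightarrow> (nat \<Rightarrow> 'a set) \<Rightarrow> real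
    \<Rightarrow> ('s, 'a) policy \<Rightarrow> bool" where
  "gmce_feasible p0 p R T Act r P \<longleftrightarrow>
     (\<forall>t<T. \<forall>s. \<forall>a\<in>Act t. 0 < pmf (P t s) a) \<and>
     (\<forall>t<T. \<forall>s. (\<Sum>a\<in>Act t. pmf (P t s) a) = 1) \<and>
     expected_reward p0 p R T P = r"

definition gmce_optimal ::
  "(real \<Rightarrow> 's \<Rightarrow> real) \<Rightarrow> 's pmf \<Rightarrow> ('a \<Rightarrow> 's \<Rightarrow> 's pmf) \<Rightarrow> ('s \<Rightarrow> 'a \<Rightarrow> real) \<Rightarrow> nat
    \<Rightarrow> (nat \<Rightarrow> 'a set) \<Rightarrow> real \<Rightarrow> ('s, 'a) policy \<Rightarrow> bool" where
  "gmce_optimal G p0 p R T Act r P \<longleftrightarrow>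
     gmce_feasible p0 p R T Act r P \<and>
     (\<forall>P'. gmce_feasible p0 p R T Act r P' \<longrightarrow>
        gen_causal_entropy G p0 p T P' \<le> gen_causal_entropy G p0 p T P)"

text \<open>
  \<open>F\<close> is a left inverse of \<open>G\<close>, as a function on the positive reals. The extensional function space
  fixes the irrelevant values at other arguments, so that uniqueness can be stated.
\<close>

definition is_G_inverse :: "(real \<Rightarrow> 's \<Rightarrow> real) \<Rightarrow> (real \<Rightarrow> 's \<Rightarrow> real) \<Rightarrow> bool" where
  "is_G_inverse G F \<longleftrightarrow>
     F \<in> {0<..} \<rightarrow>\<^sub>E (UNIV \<rightarrow> {0<..}) \<and> (\<forall>s. \<forall>q>0. F (G q s) s = q)"

definition G_inverse :: "(real \<Rightarrow> 's \<Rightarrow> real) \<Rightarrow> real \<Rightarrow> 's \<Rightarrow> real" where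
  "G_inverse G = (THE F. is_G_inverse G F)"

definition assumption_A :: "(real \<Rightarrow> 's \<Rightarrow> real) \<Rightarrow> bool" where
  "assumption_A G \<longleftrightarrow>
     (\<forall>s. \<forall>q>0. G q s > 0 \<and> (\<exists>D>0. ((\<lambda>x. G x s) has_real_derivative D) (at q))) \<and>
     (\<exists>!F. is_G_inverse G F) \<and>
     (\<exists>\<mu>. (\<forall>s. \<mu> s > 0) \<and>
        (\<forall>s. \<forall>q>0. ((\<lambda>x. ln (G x s)) has_real_derivative \<mu> s / q) (at q)))"

text \<open>
  The recursive equations, read backwards from \<open>t = T - 1\<close>: \<open>Y t s a\<close>, \<open>Za t s a\<close> and \<open>Zs t s\<close>
  stand for $Y_{a_t \mid s_t}$, $Z_{a_t \mid s_t}$ and $Z_{s_t}$. They determine these quantities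
  uniquely for \<open>t < T\<close> and \<open>a \<in> Act t\<close>.
\<close>

definition gmce_recursion ::
  "(real \<Rightarrow> 's \<Rightarrow> real) \<Rightarrow> ('a \<Rightarrow> 's \<Rightarrow> 's pmf) \<Rightarrow> ('s \<Rightarrow> 'a \<Rightarrow> real) \<Rightarrow> nat \<Rightarrow> (nat \<Rightarrow> 'a set) \<Rightarrow> real
    \<Rightarrow> (nat \<Rightarrow> 's \<Rightarrow> 'a \<Rightarrow> real) \<Rightarrow> (nat \<Rightarrow> 's \<Rightarrow> 'a \<Rightarrow> real) \<Rightarrow> (nat \<Rightarrow> 's \<Rightarrow> real) \<Rightarrow> bool" where
  "gmce_recursion G p R T Act lam Y Za Zs \<longleftrightarrow>
     (\<forall>t<T. \<forall>s. \<forall>a\<in>Act t.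
        Y t s a = lam * R s a +
          (if Suc t < T
           then measure_pmf.expectation (p a s) (\<lambda>s'. ln (G (Zs (Suc t) s') s'))
           else 0)) \<and>
     (\<forall>t<T. \<forall>s. \<forall>a\<in>Act t. Za t s a = G_inverse G (exp (Y t s a)) s) \<and>
     (\<forall>t<T. \<forall>s. Zs t s = (\<Sum>a\<in>Act t. Za t s a))"

end

theory Submission
  imports Defs
begin

text \<open>
  Assumption (A) and the common value of \<open>G 1\<close> give \<open>ln (G q s) = c + mu s * ln q\<close>, so the generalized
  entropy is, up to a constant, the Shannon entropy of the actions weighted by \<open>mu\<close>, and
  \<open>ln (G (Zs t s) s)\<close> is the value function of the entropy-regularized control problem with
  reward \<open>lam * R\<close>. A telescoping argument shows that reward plus entropy of a policy is the optimal
  regularized value minus the expected weighted Kullback-Leibler divergence from the softmax policy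
  of the recursion. The reward of the softmax policy depends continuously on \<open>lam\<close>, and by the
  intermediate value theorem it attains the reward \<open>r\<close> of any positive policy. For such a \<open>lam\<close> the
  softmax policy is feasible, so the divergence of an optimal policy from it vanishes, that is,
  they agree in all reachable states. No concavity or Lagrange multiplier theorem is needed.
\<close>

section \<open>State marginals of trajectories\<close>

text \<open>Runs forward in time, whereas \<open>rollout\<close> builds trajectories from the front;
  the forward form suits the telescoping and continuity arguments.\<close>

primrec state_law ::
  "'s pmf \<Rightarrow> ('a \<Rightarrow> 's \<Rightarrow> 's pmf) \<Rightarrow> ('s, 'a) policy \<Rightarrow> nat \<Rightarrow> 's pmf" where
  "state_law p0 p P 0 = p0"
| "state_law p0 p P (Suc t) = state_law p0 p P t \<bind> (\<lambda>s. P t s \<bind> (\<lambda>a. p a s))"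

text \<open>Absorbing the first transition into the initial law reconciles the two directions of
  recursion.\<close>

lemma state_law_shift:
  "state_law (p0 \<bind> (\<lambda>s. P 0 s \<bind> (\<lambda>a. p a s))) p (\<lambda>t. P (Suc t)) k = state_law p0 p P (Suc k)"
  by (induction k) auto

text \<open>Dropping the head of the trajectory replaces \<open>p0\<close> by its one-step image and
  advances the clock, so the induction on \<open>k\<close> keeps \<open>n\<close>, \<open>t\<close>
  and \<open>p0\<close> arbitrary.\<close>

lemma map_nth_rollout:
  assumes "k < n"
  shows "map_pmf (\<lambda>w. w ! k) (p0 \<bind> rollout p P n t) =
    state_law p0 p (\<lambda>i. P (t + i)) k \<bind> (\<lambda>s. map_pmf (Pair s) (P (t + k) s))"
  using assms
proof (induction k arbitrary: n t p0)
  case 0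
  then obtain m where n: "n = Suc m"
    by (cases n) auto
  show ?case
    by (simp add: n map_bind_pmf pmf.map_comp o_def map_pmf_def[of "Pair _"])
next
  case (Suc k)
  then obtain m where n: "n = Suc m" and "k < m"
    by (cases n) auto
  have "map_pmf (\<lambda>w. w ! Suc k) (p0 \<bind> rollout p P n t) =
     map_pmf (\<lambda>w. w ! k) ((p0 \<bind> (\<lambda>s. P t s \<bind> (\<lambda>a. p a s))) \<bind> rollout p P m (Suc t))"
    by (simp add: n map_bind_pmf pmf.map_comp o_def bind_assoc_pmf)
  also have "\<dots> = state_law (p0 \<bind> (\<lambda>s. P t s \<bind> (\<lambda>a. p a s))) p (\<lambda>i. P (Suc t + i)) k
      \<bind> (\<lambda>s. map_pmf (Pair s) (P (Suc t + k) s))"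
    by (rule Suc.IH[OF \<open>k < m\<close>])
  also have "\<dots> = state_law p0 p (\<lambda>i. P (t + i)) (Suc k) \<bind> (\<lambda>s. map_pmf (Pair s) (P (t + Suc k) s))"
    using state_law_shift[of p0 "\<lambda>i. P (t + i)" p k] by simp
  finally show ?case .
qed

lemma map_nth_trajectory_law:
  "k < T \<Longrightarrow> map_pmf (\<lambda>w. w ! k) (trajectory_law p0 p T P) =
    state_law p0 p P k \<bind> (\<lambda>s. map_pmf (Pair s) (P k s))"
  using map_nth_rollout[of k T p0 p P 0] by (simp add: trajectory_law_def)

text \<open>Translates the reachability premise of the theorem into the support of
  \<open>state_law\<close>.\<close>

lemma prob_state_at:
  assumes "k < T"
  shows "measure_pmf.prob (trajectory_law p0 p T P) {w. state_at w k = s} =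
    pmf (state_law p0 p P k) s"
proof -
  have "map_pmf (\<lambda>w. fst (w ! k)) (trajectory_law p0 p T P) =
      map_pmf fst (map_pmf (\<lambda>w. w ! k) (trajectory_law p0 p T P))"
    by (simp add: pmf.map_comp o_def)
  also have "\<dots> = state_law p0 p P k"
    by (simp add: map_nth_trajectory_law[OF assms] map_bind_pmf pmf.map_comp o_def
        map_pmf_const bind_return_pmf')
  finally show ?thesis
    by (simp add: pmf_map vimage_def flip: \<open>_ = state_law p0 p P k\<close>)
qed

section \<open>Expectations of sums along trajectories\<close>

lemma finite_set_pmf_rollout:
  fixes p :: "'a::finite \<Rightarrow> 's::finite \<Rightarrow> 's pmf"
  shows "finite (set_pmf (rollout p P n t s))"
  by (induction n arbitrary: t s) auto

text \<open>By linearity only the time marginals enter. The summand may depend on time so that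
  log-probabilities of time-dependent policies are covered.\<close>

definition expected_sum ::
  "'s::finite pmf \<Rightarrow> ('a::finite \<Rightarrow> 's \<Rightarrow> 's pmf) \<Rightarrow> nat \<Rightarrow> ('s, 'a) policy \<Rightarrow>
    (nat \<Rightarrow> 's \<Rightarrow> 'a \<Rightarrow> real) \<Rightarrow> real" where
  "expected_sum p0 p T P f =
    (\<Sum>t<T. \<Sum>s\<in>UNIV. pmf (state_law p0 p P t) s * (\<Sum>a\<in>UNIV. pmf (P t s) a * f t s a))"

lemma expectation_trajectory_law:
  fixes p :: "'a::finite \<Rightarrow> 's::finite \<Rightarrow> 's pmf"
  shows "measure_pmf.expectation (trajectory_law p0 p T P)
      (\<lambda>w. \<Sum>t<T. f t (state_at w t) (action_at w t)) = expected_sum p0 p T P f"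
proof -
  let ?L = "trajectory_law p0 p T P"
  have fin: "finite (set_pmf ?L)"
    by (auto simp: trajectory_law_def finite_set_pmf_rollout)
  have "measure_pmf.expectation ?L (\<lambda>w. \<Sum>t<T. f t (state_at w t) (action_at w t)) =
      (\<Sum>t<T. measure_pmf.expectation ?L (\<lambda>w. f t (state_at w t) (action_at w t)))"
    by (intro Bochner_Integration.integral_sum integrable_measure_pmf_finite fin)
  also have "\<dots> = expected_sum p0 p T P f"
    unfolding expected_sum_def
  proof (intro sum.cong refl)
    fix t assume "t \<in> {..<T}"
    have "measure_pmf.expectation ?L (\<lambda>w. f t (state_at w t) (action_at w t)) =
       measure_pmf.expectation (map_pmf (\<lambda>w. w ! t) ?L) (\<lambda>x. f t (fst x) (snd x))"
      by simp
    also have "\<dots> = measure_pmf.expectation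
        (state_law p0 p P t \<bind> (\<lambda>s. map_pmf (Pair s) (P t s))) (\<lambda>x. f t (fst x) (snd x))"
      using \<open>t \<in> {..<T}\<close> by (subst map_nth_trajectory_law) auto
    also have "\<dots> = (\<Sum>s\<in>UNIV. pmf (state_law p0 p P t) s * (\<Sum>a\<in>UNIV. pmf (P t s) a * f t s a))"
      by (subst pmf_expectation_bind[of UNIV]) (auto simp: integral_measure_pmf_real[of UNIV] mult.commute)
    finally show "measure_pmf.expectation ?L (\<lambda>w. f t (state_at w t) (action_at w t)) = \<dots>" .
  qed
  finally show ?thesis .
qed

lemma pmf_state_law_Suc:
  fixes p :: "'a::finite \<Rightarrow> 's::finite \<Rightarrow> 's pmf"
  shows "pmf (state_law p0 p P (Suc t)) s' =
    (\<Sum>s\<in>UNIV. pmf (state_law p0 p P t) s * (\<Sum>a\<in>UNIV. pmf (P t s) a * pmf (p a s) s'))"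
  by (simp add: pmf_bind integral_measure_pmf_real[of UNIV] mult.commute)

lemma sum_pmf_UNIV: "(\<Sum>x\<in>UNIV. pmf (q :: 'b::finite pmf) x) = 1"
  by (rule sum_pmf_eq_1) auto

lemma expected_sum_add:
  "expected_sum p0 p T P (\<lambda>t s a. f t s a + g t s a) = expected_sum p0 p T P f + expected_sum p0 p T P g"
  by (simp add: expected_sum_def distrib_left sum.distrib)

lemma expected_sum_cmult:
  "expected_sum p0 p T P (\<lambda>t s a. c * f t s a) = c * expected_sum p0 p T P f"
  by (simp add: expected_sum_def sum_distrib_left mult_ac)

lemma expected_sum_const: "expected_sum p0 p T P (\<lambda>t s a. c) = real T * c"
  by (simp add: expected_sum_def sum_pmf_UNIV flip: sum_distrib_right)

text \<open>Pairs outside the supports carry weight zero; comparing on the supports alone avoids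
  logarithms of zero probabilities.\<close>

lemma expected_sum_mono:
  assumes "\<And>t s a. t < T \<Longrightarrow> s \<in> set_pmf (state_law p0 p P t) \<Longrightarrow> a \<in> set_pmf (P t s) \<Longrightarrow> f t s a \<le> g t s a"
  shows "expected_sum p0 p T P f \<le> expected_sum p0 p T P g"
  unfolding expected_sum_def
proof (intro sum_mono)
  fix t s assume "t \<in> {..<T}"
  show "pmf (state_law p0 p P t) s * (\<Sum>a\<in>UNIV. pmf (P t s) a * f t s a)
      \<le> pmf (state_law p0 p P t) s * (\<Sum>a\<in>UNIV. pmf (P t s) a * g t s a)"
  proof (cases "s \<in> set_pmf (state_law p0 p P t)")
    case True
    show ?thesis
    proof (rule mult_left_mono[OF sum_mono])
      fix a
      show "pmf (P t s) a * f t s a \<le> pmf (P t s) a * g t s a"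
        using assms[OF _ True, of a] \<open>t \<in> {..<T}\<close>
        by (cases "a \<in> set_pmf (P t s)") (auto simp: set_pmf_iff intro!: mult_left_mono)
    qed simp
  qed (simp add: set_pmf_iff)
qed

lemma expected_sum_cong:
  assumes "\<And>t s a. t < T \<Longrightarrow> s \<in> set_pmf (state_law p0 p P t) \<Longrightarrow> a \<in> set_pmf (P t s) \<Longrightarrow> f t s a = g t s a"
  shows "expected_sum p0 p T P f = expected_sum p0 p T P g"
  by (intro antisym expected_sum_mono) (auto simp: assms)

text \<open>Performance difference identity: the expected one-step changes of \<open>V\<close> add
  up to minus its initial mean. \<open>V\<close> is free apart from its terminal value, so both the
  soft and the unregularized value function can be inserted.\<close>

lemma expected_sum_telescope:
  fixes p :: "'a::finite \<Rightarrow> 's::finite \<Rightarrow> 's pmf"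
  assumes "\<And>s. V T s = 0"
  shows "expected_sum p0 p T P q = (\<Sum>s\<in>UNIV. pmf p0 s * V 0 s) +
    expected_sum p0 p T P (\<lambda>t s a. q t s a + (\<Sum>s'\<in>UNIV. pmf (p a s) s' * V (Suc t) s') - V t s)"
proof -
  define m where "m t = (\<Sum>s\<in>UNIV. pmf (state_law p0 p P t) s * V t s)" for t
  have m_Suc: "m (Suc t) = (\<Sum>s\<in>UNIV. pmf (state_law p0 p P t) s *
      (\<Sum>a\<in>UNIV. pmf (P t s) a * (\<Sum>s'\<in>UNIV. pmf (p a s) s' * V (Suc t) s')))" for t
  proof -
    have "m (Suc t) = (\<Sum>s'\<in>UNIV. \<Sum>s\<in>UNIV. \<Sum>a\<in>UNIV. pmf (state_law p0 p P t) s *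
        (pmf (P t s) a * (pmf (p a s) s' * V (Suc t) s')))"
      unfolding m_def pmf_state_law_Suc by (simp add: sum_distrib_right sum_distrib_left mult_ac)
    also have "\<dots> = (\<Sum>s\<in>UNIV. \<Sum>s'\<in>UNIV. \<Sum>a\<in>UNIV. pmf (state_law p0 p P t) s *
        (pmf (P t s) a * (pmf (p a s) s' * V (Suc t) s')))"
      by (rule sum.swap)
    also have "\<dots> = (\<Sum>s\<in>UNIV. \<Sum>a\<in>UNIV. \<Sum>s'\<in>UNIV. pmf (state_law p0 p P t) s *
        (pmf (P t s) a * (pmf (p a s) s' * V (Suc t) s')))"
      by (intro sum.cong refl sum.swap)
    finally show ?thesis
      by (simp add: sum_distrib_left)
  qed
  have "expected_sum p0 p T P (\<lambda>t s a. (\<Sum>s'\<in>UNIV. pmf (p a s) s' * V (Suc t) s') - V t s) =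
      (\<Sum>t<T. m (Suc t) - m t)"
    unfolding m_Suc unfolding m_def
    by (simp add: expected_sum_def right_diff_distrib sum_subtractf sum_pmf_UNIV
        flip: sum_distrib_right)
  also have "\<dots> = - m 0"
    by (simp add: sum_lessThan_telescope m_def[of T] assms)
  finally have "expected_sum p0 p T P (\<lambda>t s a. (\<Sum>s'\<in>UNIV. pmf (p a s) s' * V (Suc t) s') - V t s) =
      - (\<Sum>s\<in>UNIV. pmf p0 s * V 0 s)"
    by (simp add: m_def)
  then show ?thesis
    using expected_sum_add[of p0 p T P q "\<lambda>t s a. (\<Sum>s'\<in>UNIV. pmf (p a s) s' * V (Suc t) s') - V t s"]
    by (simp add: add_diff_eq)
qed

text \<open>Nonpositive terms with a nonnegative total all vanish, and a reachable state has
  positive weight. The sign is assumed only after summing over actions, which is what Gibbs'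
  inequality supplies.\<close>

lemma expected_sum_nonpos_eq_0:
  assumes nonpos: "\<And>t s. t < T \<Longrightarrow> (\<Sum>a\<in>UNIV. pmf (P t s) a * f t s a) \<le> 0"
    and "0 \<le> expected_sum p0 p T P f"
    and "t < T" "s \<in> set_pmf (state_law p0 p P t)"
  shows "(\<Sum>a\<in>UNIV. pmf (P t s) a * f t s a) = 0"
proof -
  let ?g = "\<lambda>t s. - (pmf (state_law p0 p P t) s * (\<Sum>a\<in>UNIV. pmf (P t s) a * f t s a))"
  have nonneg: "0 \<le> ?g t s" if "t < T" for t s
    using nonpos[OF that] by (simp only: neg_0_le_iff_le) (rule mult_nonneg_nonpos; simp)
  have "(\<Sum>(t, s)\<in>{..<T} \<times> UNIV. ?g t s) = - expected_sum p0 p T P f"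
    unfolding expected_sum_def sum.cartesian_product[symmetric] by (simp only: sum_negf)
  then have "(\<Sum>(t, s)\<in>{..<T} \<times> UNIV. ?g t s) = 0"
    using assms(2) sum_nonneg[of "{..<T} \<times> UNIV" "\<lambda>(t, s). ?g t s"] nonneg by fastforce
  then have "\<forall>x\<in>{..<T} \<times> UNIV. (case x of (t, s) \<Rightarrow> ?g t s) = 0"
    using nonneg by (subst (asm) sum_nonneg_eq_0_iff) (simp_all only: finite_SigmaI finite finite_lessThan, fastforce)
  then have "?g t s = 0"
    using assms(3) by (auto dest!: bspec[of _ _ "(t, s)"])
  then show ?thesis
    using assms(4) by (simp add: set_pmf_iff)
qed

lemma set_state_law_mono:
  assumes "\<And>i s. i < t \<Longrightarrow> set_pmf (P i s) \<subseteq> set_pmf (P' i s)"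
  shows "set_pmf (state_law p0 p P t) \<subseteq> set_pmf (state_law p0 p P' t)"
  using assms
proof (induction t)
  case (Suc t)
  have "set_pmf (state_law p0 p P t) \<subseteq> set_pmf (state_law p0 p P' t)"
    using Suc by auto
  moreover have "set_pmf (P t s) \<subseteq> set_pmf (P' t s)" for s
    using Suc.prems by auto
  ultimately show ?case
    by fastforce
qed simp

section \<open>Entropy-regularized dynamic programming\<close>

text \<open>Apply \<open>ln u <= u - 1\<close> at \<open>u = y a / x a\<close> with weight
  \<open>x a\<close>; the upper bounds \<open>y a - x a\<close> sum to zero. Equality of the sums
  forces \<open>u = 1\<close> for each \<open>a\<close>.\<close>

lemma gibbs_inequality:
  fixes x y :: "'b \<Rightarrow> real"
  assumes "finite A" "\<And>a. a \<in> A \<Longrightarrow> 0 < x a" "\<And>a. a \<in> A \<Longrightarrow> 0 < y a"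
    and "sum x A = sum y A"
  shows "(\<Sum>a\<in>A. x a * (ln (y a) - ln (x a))) \<le> 0"
    and "0 \<le> (\<Sum>a\<in>A. x a * (ln (y a) - ln (x a))) \<Longrightarrow> a \<in> A \<Longrightarrow> x a = y a"
proof -
  have le: "x a * (ln (y a) - ln (x a)) \<le> y a - x a" if "a \<in> A" for a
  proof -
    have "x a * ln (y a / x a) \<le> x a * (y a / x a - 1)"
      using assms(2,3)[OF that] by (intro mult_left_mono ln_le_minus_one) auto
    also have "\<dots> = y a - x a"
      using assms(2)[OF that] by (simp add: field_simps)
    finally show ?thesis
      using assms(2,3)[OF that] by (simp add: ln_div)
  qed
  have sum_diff: "(\<Sum>a\<in>A. y a - x a) = 0"
    using assms(4) by (simp add: sum_subtractf)
  show "(\<Sum>a\<in>A. x a * (ln (y a) - ln (x a))) \<le> 0"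
    using sum_mono[of A "\<lambda>a. x a * (ln (y a) - ln (x a))" "\<lambda>a. y a - x a"] le sum_diff by simp
  assume ge: "0 \<le> (\<Sum>a\<in>A. x a * (ln (y a) - ln (x a)))" and "a \<in> A"
  have "(\<Sum>a\<in>A. (y a - x a) - x a * (ln (y a) - ln (x a))) \<le> 0"
    using ge sum_diff by (simp add: sum_subtractf)
  then have "(\<Sum>a\<in>A. (y a - x a) - x a * (ln (y a) - ln (x a))) = 0"
    using le by (intro antisym sum_nonneg) auto
  then have "(y a - x a) - x a * (ln (y a) - ln (x a)) = 0"
    using le \<open>a \<in> A\<close> by (subst (asm) sum_nonneg_eq_0_iff[OF assms(1)]) auto
  then have "x a * ln (y a / x a) = x a * (y a / x a - 1)"
    using assms(2,3)[OF \<open>a \<in> A\<close>] by (simp add: ln_div right_diff_distrib)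
  then have "ln (y a / x a) = y a / x a - 1"
    using assms(2)[OF \<open>a \<in> A\<close>] by simp
  then have "y a / x a = 1"
    using assms(2,3)[OF \<open>a \<in> A\<close>] by (intro ln_eq_minus_one) auto
  then show "x a = y a"
    using assms(2)[OF \<open>a \<in> A\<close>] by simp
qed

text \<open>\<open>mu s\<close> acts as a state-dependent temperature; nonempty action sets make the
  partition sums positive.\<close>

locale soft_control =
  fixes p0 :: "'s::finite pmf"
    and p :: "'a::finite \<Rightarrow> 's \<Rightarrow> 's pmf"
    and T :: nat
    and Act :: "nat \<Rightarrow> 'a set"
    and mu :: "'s \<Rightarrow> real"
  assumes mu_pos: "\<And>s. 0 < mu s"
    and Act_nonempty: "\<And>t. t < T \<Longrightarrow> Act t \<noteq> {}"
begin

text \<open>Support equal to \<open>Act t\<close> expresses the positivity and normalization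
  constraints at once.\<close>

definition positive_policy :: "('s, 'a) policy \<Rightarrow> bool" where
  "positive_policy P \<longleftrightarrow> (\<forall>t<T. \<forall>s. set_pmf (P t s) = Act t)"

definition backup :: "('s \<Rightarrow> 'a \<Rightarrow> real) \<Rightarrow> ('s \<Rightarrow> real) \<Rightarrow> 's \<Rightarrow> 'a \<Rightarrow> real" where
  "backup q v s a = q s a + (\<Sum>s'\<in>UNIV. pmf (p a s) s' * v s')"

text \<open>Value functions are indexed by the number of remaining steps; \<open>soft_value\<close> and \<open>max_value\<close>
  are indexed by time.\<close>

primrec soft_value_rem :: "('s \<Rightarrow> 'a \<Rightarrow> real) \<Rightarrow> nat \<Rightarrow> 's \<Rightarrow> real" where
  "soft_value_rem q 0 s = 0"
| "soft_value_rem q (Suc n) s =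
    mu s * ln (\<Sum>a\<in>Act (T - Suc n). exp (backup q (soft_value_rem q n) s a / mu s))"

primrec max_value_rem :: "('s \<Rightarrow> 'a \<Rightarrow> real) \<Rightarrow> nat \<Rightarrow> 's \<Rightarrow> real" where
  "max_value_rem q 0 s = 0"
| "max_value_rem q (Suc n) s = Max (backup q (max_value_rem q n) s ` Act (T - Suc n))"

definition "soft_value q t = soft_value_rem q (T - t)"
definition "max_value q t = max_value_rem q (T - t)"
definition "soft_Q q t = backup q (soft_value q (Suc t))"
definition "max_Q q t = backup q (max_value q (Suc t))"

text \<open>Softmax over \<open>Act t\<close> at temperature \<open>mu s\<close>;
  \<open>soft_value q t s / mu s\<close> is the log-partition term that normalizes it.\<close>

definition soft_policy :: "('s \<Rightarrow> 'a \<Rightarrow> real) \<Rightarrow> ('s, 'a) policy" where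
  "soft_policy q t s =
    embed_pmf (\<lambda>a. if a \<in> Act t then exp ((soft_Q q t s a - soft_value q t s) / mu s) else 0)"

lemma soft_value_end [simp]: "soft_value q T s = 0"
  by (simp add: soft_value_def)

lemma max_value_end [simp]: "max_value q T s = 0"
  by (simp add: max_value_def)

lemma soft_value_step:
  "t < T \<Longrightarrow> soft_value q t s = mu s * ln (\<Sum>a\<in>Act t. exp (soft_Q q t s a / mu s))"
  by (simp add: soft_value_def soft_Q_def flip: Suc_diff_Suc)

lemma max_value_step: "t < T \<Longrightarrow> max_value q t s = Max (max_Q q t s ` Act t)"
  by (simp add: max_value_def max_Q_def flip: Suc_diff_Suc)

lemma sum_exp_soft_Q_pos: "t < T \<Longrightarrow> 0 < (\<Sum>a\<in>Act t. exp (soft_Q q t s a / mu s))"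
  using Act_nonempty by (intro sum_pos) auto

lemma sum_exp_soft_Q:
  "t < T \<Longrightarrow> (\<Sum>a\<in>Act t. exp (soft_Q q t s a / mu s)) = exp (soft_value q t s / mu s)"
  using mu_pos[of s] sum_exp_soft_Q_pos[of t q s] by (simp add: soft_value_step)

lemma sum_soft_policy:
  "t < T \<Longrightarrow> (\<Sum>a\<in>Act t. exp ((soft_Q q t s a - soft_value q t s) / mu s)) = 1"
  by (simp add: diff_divide_distrib exp_diff sum_exp_soft_Q flip: sum_divide_distrib)

lemma pmf_soft_policy:
  assumes "t < T"
  shows "pmf (soft_policy q t s) a =
    (if a \<in> Act t then exp ((soft_Q q t s a - soft_value q t s) / mu s) else 0)"
  unfolding soft_policy_def
proof (rule pmf_embed_pmf)
  let ?w = "\<lambda>a. if a \<in> Act t then exp ((soft_Q q t s a - soft_value q t s) / mu s) else 0"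
  have "(\<Sum>a\<in>UNIV. ?w a) = 1"
    using sum_soft_policy[OF assms] by (simp add: sum.If_cases)
  then show "(\<integral>\<^sup>+ a. ennreal (?w a) \<partial>count_space UNIV) = 1"
    by (subst nn_integral_count_space_finite) (auto simp: sum_ennreal)
qed auto

lemma set_soft_policy: "t < T \<Longrightarrow> set_pmf (soft_policy q t s) = Act t"
  by (auto simp: set_pmf_iff pmf_soft_policy split: if_splits)

lemma positive_soft_policy: "positive_policy (soft_policy q)"
  by (simp add: positive_policy_def set_soft_policy)

section \<open>Reward, entropy and divergence from the softmax policy\<close>

definition "initial_mean v = (\<Sum>s\<in>UNIV. pmf p0 s * v s)"

abbreviation "total_mean \<equiv> expected_sum p0 p T"

abbreviation reward :: "('s \<Rightarrow> 'a \<Rightarrow> real) \<Rightarrow> ('s, 'a) policy \<Rightarrow> real" where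
  "reward q P \<equiv> total_mean P (\<lambda>t s a. q s a)"

definition entropy :: "('s, 'a) policy \<Rightarrow> real" where
  "entropy P = total_mean P (\<lambda>t s a. - mu s * ln (pmf (P t s) a))"

text \<open>The last term is minus the expected sum of the \<open>mu\<close>-weighted Kullback-Leibler divergences of
  \<open>P t s\<close> from \<open>soft_policy q t s\<close>.\<close>

lemma reward_plus_entropy:
  assumes "positive_policy P"
  shows "reward q P + entropy P = initial_mean (soft_value q 0) +
    total_mean P (\<lambda>t s a. mu s * (ln (pmf (soft_policy q t s) a) - ln (pmf (P t s) a)))"
proof -
  have "reward q P = initial_mean (soft_value q 0) +
      total_mean P (\<lambda>t s a. q s a + (\<Sum>s'\<in>UNIV. pmf (p a s) s' * soft_value q (Suc t) s') - soft_value q t s)"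
    unfolding initial_mean_def by (rule expected_sum_telescope) simp
  \<comment> \<open>On \<open>Act t\<close> the soft advantage is \<open>mu s\<close> times the
    log-probability of the softmax policy; \<open>P\<close> gives other actions no mass.\<close>
  also have "total_mean P (\<lambda>t s a. q s a + (\<Sum>s'\<in>UNIV. pmf (p a s) s' * soft_value q (Suc t) s') - soft_value q t s)
      = total_mean P (\<lambda>t s a. mu s * ln (pmf (soft_policy q t s) a))"
  proof (rule expected_sum_cong)
    fix t s a assume "t < T" "a \<in> set_pmf (P t s)"
    then have "a \<in> Act t"
      using assms by (auto simp: positive_policy_def)
    then show "q s a + (\<Sum>s'\<in>UNIV. pmf (p a s) s' * soft_value q (Suc t) s') - soft_value q t s =
        mu s * ln (pmf (soft_policy q t s) a)"
      using mu_pos[of s] \<open>t < T\<close> by (simp add: pmf_soft_policy soft_Q_def backup_def)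
  qed
  finally show ?thesis
    unfolding entropy_def by (simp add: right_diff_distrib flip: expected_sum_add)
qed

text \<open>The softmax policy has zero divergence from itself.\<close>

lemma reward_plus_entropy_soft_policy:
  "reward q (soft_policy q) + entropy (soft_policy q) = initial_mean (soft_value q 0)"
  using reward_plus_entropy[OF positive_soft_policy, of q q] by (simp add: expected_sum_const)

lemma sum_pmf_Act: "t < T \<Longrightarrow> positive_policy P \<Longrightarrow> (\<Sum>a\<in>Act t. pmf (P t s) a) = 1"
  by (rule sum_pmf_eq_1) (auto simp: positive_policy_def)

lemma sum_over_Act:
  assumes "t < T" "positive_policy P"
  shows "(\<Sum>a\<in>UNIV. pmf (P t s) a * h a) = (\<Sum>a\<in>Act t. pmf (P t s) a * h a)"
  using assms by (intro sum.mono_neutral_right) (auto simp: positive_policy_def pmf_eq_0_set_pmf)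

lemma policy_gibbs:
  assumes "t < T" "positive_policy P" "positive_policy P'"
  shows "(\<Sum>a\<in>UNIV. pmf (P t s) a * (ln (pmf (P' t s) a) - ln (pmf (P t s) a))) \<le> 0"
    and "0 \<le> (\<Sum>a\<in>UNIV. pmf (P t s) a * (ln (pmf (P' t s) a) - ln (pmf (P t s) a)))
      \<Longrightarrow> a \<in> Act t \<Longrightarrow> pmf (P t s) a = pmf (P' t s) a"
proof -
  have pos: "0 < pmf (Q t s) a" if "a \<in> Act t" "positive_policy Q" for Q a
    using assms(1) that by (auto simp: positive_policy_def intro!: pmf_positive)
  have sums: "sum (pmf (P t s)) (Act t) = sum (pmf (P' t s)) (Act t)"
    using sum_pmf_Act[OF assms(1)] assms(2,3) by simp
  note gibbs = gibbs_inequality[OF finite pos[OF _ assms(2)] pos[OF _ assms(3)] sums]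
  show "(\<Sum>a\<in>UNIV. pmf (P t s) a * (ln (pmf (P' t s) a) - ln (pmf (P t s) a))) \<le> 0"
    unfolding sum_over_Act[OF assms(1,2)] by (rule gibbs(1))
  show "pmf (P t s) a = pmf (P' t s) a"
    if "0 \<le> (\<Sum>a\<in>UNIV. pmf (P t s) a * (ln (pmf (P' t s) a) - ln (pmf (P t s) a)))" "a \<in> Act t"
    using that unfolding sum_over_Act[OF assms(1,2)] by - (rule gibbs(2))
qed

text \<open>With equal rewards, the entropy comparison makes reward plus entropy of \<open>P\<close>
  at least the optimal regularized value, so the divergence term is nonnegative. Its contribution
  from each state is nonpositive, hence the equality case of Gibbs' inequality applies in every
  reachable state.\<close>

lemma entropy_le_imp_soft_policy:
  assumes P: "positive_policy P" and rew: "reward R P = reward R (soft_policy (\<lambda>s a. lam * R s a))"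
    and ent: "entropy (soft_policy (\<lambda>s a. lam * R s a)) \<le> entropy P"
    and "t < T" "s \<in> set_pmf (state_law p0 p P t)" "a \<in> Act t"
  shows "pmf (P t s) a = pmf (soft_policy (\<lambda>s a. lam * R s a) t s) a"
proof -
  let ?q = "\<lambda>s a. lam * R s a"
  let ?d = "\<lambda>t s. \<Sum>a\<in>UNIV. pmf (P t s) a * (ln (pmf (soft_policy ?q t s) a) - ln (pmf (P t s) a))"
  have "reward ?q P = reward ?q (soft_policy ?q)"
    using rew by (simp add: expected_sum_cmult)
  then have "0 \<le> total_mean P (\<lambda>t s a. mu s * (ln (pmf (soft_policy ?q t s) a) - ln (pmf (P t s) a)))"
    using reward_plus_entropy[OF P, of ?q] reward_plus_entropy_soft_policy[of ?q] ent by simp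
  moreover have d: "(\<Sum>a\<in>UNIV. pmf (P t s) a * (mu s * (ln (pmf (soft_policy ?q t s) a) - ln (pmf (P t s) a))))
      = mu s * ?d t s" for t s
    by (simp add: sum_distrib_left mult_ac)
  moreover have "mu s * ?d t s \<le> 0" if "t < T" for t s
    using policy_gibbs(1)[OF that P positive_soft_policy] mu_pos[of s] by (simp add: mult_nonneg_nonpos)
  ultimately have "mu s * ?d t s = 0"
    unfolding d[symmetric] using assms(4,5)
    by (intro expected_sum_nonpos_eq_0[where T = T and f =
          "\<lambda>t s a. mu s * (ln (pmf (soft_policy ?q t s) a) - ln (pmf (P t s) a))"]) auto
  then have "?d t s = 0"
    using mu_pos[of s] by simp
  then show ?thesis
    using \<open>a \<in> Act t\<close> by (intro policy_gibbs(2)[OF \<open>t < T\<close> P positive_soft_policy]) simp_all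
qed

section \<open>Range of the softmax reward\<close>

lemma entropy_bounded: "\<exists>C>0. \<forall>P. entropy P \<le> C"
proof -
  \<comment> \<open>Again \<open>ln u <= u - 1\<close>, now at \<open>u = 1 / x\<close>.\<close>
  have ln_bound: "- x * ln x \<le> 1" if "0 \<le> x" for x :: real
  proof (cases "x = 0")
    case False
    then have "x * ln (1 / x) \<le> x * (1 / x - 1)"
      using that by (intro mult_left_mono ln_le_minus_one) auto
    moreover have "x * (1 / x - 1) = 1 - x" "x * ln (1 / x) = - x * ln x"
      using False that by (simp_all add: ln_div right_diff_distrib)
    ultimately show ?thesis
      using that by linarith
  qed simp
  have "entropy P \<le> (\<Sum>t<T. \<Sum>s\<in>UNIV. mu s * CARD('a))" for P
    unfolding entropy_def expected_sum_def
  proof (intro sum_mono)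
    fix t and s :: 's
    have "(\<Sum>a\<in>UNIV. pmf (P t s) a * (- mu s * ln (pmf (P t s) a))) =
        mu s * (\<Sum>a\<in>UNIV. - pmf (P t s) a * ln (pmf (P t s) a))"
      by (simp add: sum_distrib_left mult_ac)
    also have "\<dots> \<le> mu s * (\<Sum>a\<in>(UNIV::'a set). 1)"
      using mu_pos[of s] by (intro mult_left_mono sum_mono ln_bound) auto
    finally have "(\<Sum>a\<in>UNIV. pmf (P t s) a * (- mu s * ln (pmf (P t s) a))) \<le> mu s * CARD('a)"
      by simp
    then have "pmf (state_law p0 p P t) s * (\<Sum>a\<in>UNIV. pmf (P t s) a * (- mu s * ln (pmf (P t s) a)))
        \<le> pmf (state_law p0 p P t) s * (mu s * CARD('a))"
      by (rule mult_left_mono) simp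
    also have "\<dots> \<le> 1 * (mu s * CARD('a))"
      using mu_pos[of s] by (intro mult_right_mono pmf_le_1) auto
    finally show "pmf (state_law p0 p P t) s * (\<Sum>a\<in>UNIV. pmf (P t s) a * (- mu s * ln (pmf (P t s) a)))
        \<le> mu s * CARD('a)"
      by simp
  qed
  moreover have "0 \<le> (\<Sum>t<T. \<Sum>s\<in>UNIV. mu s * CARD('a))"
    by (intro sum_nonneg) (use mu_pos in \<open>auto intro: less_imp_le\<close>)
  \<comment> \<open>The added one makes the bound strictly positive, so that it later yields a
    positive multiplier \<open>C / d\<close>.\<close>
  ultimately have "\<forall>P. entropy P \<le> (\<Sum>t<T. \<Sum>s\<in>UNIV. mu s * CARD('a)) + 1"
    by (meson add_increasing2 zero_le_one)
  then show ?thesis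
    using \<open>0 \<le> _\<close> by (intro exI[of _ "(\<Sum>t<T. \<Sum>s\<in>UNIV. mu s * CARD('a)) + 1"]) auto
qed

text \<open>A log-sum-exp dominates each of its exponents.\<close>

lemma soft_Q_le_soft_value:
  assumes "t < T" "a \<in> Act t"
  shows "soft_Q q t s a \<le> soft_value q t s"
proof -
  have "exp (soft_Q q t s a / mu s) \<le> exp (soft_value q t s / mu s)"
    unfolding sum_exp_soft_Q[OF assms(1), symmetric]
    using assms(2) by (intro member_le_sum) auto
  then show ?thesis
    using mu_pos[of s] by (simp add: divide_le_cancel)
qed

lemma max_Q_le_max_value: "t < T \<Longrightarrow> a \<in> Act t \<Longrightarrow> max_Q q t s a \<le> max_value q t s"
  by (auto simp: max_value_step)

text \<open>Backward induction in time: the soft value dominates the soft backup at every action, in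
  particular at one that maximizes \<open>max_Q\<close>.\<close>

lemma max_value_le_soft_value:
  assumes "0 \<le> lam"
  shows "t \<le> T \<Longrightarrow> lam * max_value q t s \<le> soft_value (\<lambda>s a. lam * q s a) t s"
proof (induction t arbitrary: s rule: inc_induct)
  case (step t)
  have "max_value q t s \<in> max_Q q t s ` Act t"
    using Act_nonempty step by (subst max_value_step) (auto intro!: Max_in)
  then obtain a where a: "a \<in> Act t" "max_value q t s = max_Q q t s a"
    by auto
  have "lam * max_Q q t s a = lam * q s a + (\<Sum>s'\<in>UNIV. pmf (p a s) s' * (lam * max_value q (Suc t) s'))"
    by (simp add: max_Q_def backup_def distrib_left sum_distrib_left mult_ac)
  also have "\<dots> \<le> soft_Q (\<lambda>s a. lam * q s a) t s a"
    unfolding soft_Q_def backup_def by (intro add_mono order_refl sum_mono mult_left_mono step.IH) auto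
  also have "\<dots> \<le> soft_value (\<lambda>s a. lam * q s a) t s"
    using step a by (intro soft_Q_le_soft_value) auto
  finally show ?case
    by (simp add: a)
qed simp

text \<open>If \<open>P\<close> attains the maximal reward then, since it is positive, every action is optimal in
  every reachable state, and all policies supported on \<open>Act\<close> attain the maximal reward.
  Otherwise the bounded entropy term is negligible for large multipliers.\<close>

lemma soft_policy_reward_ge:
  assumes P: "positive_policy P"
  shows "\<exists>lam. reward R P \<le> reward R (soft_policy (\<lambda>s a. lam * R s a))"
proof -
  let ?pi = "\<lambda>lam. soft_policy (\<lambda>s a. lam * R s a)"
  \<comment> \<open>Advantage under the unregularized optimal values: nonpositive on
    \<open>Act\<close>, and by telescoping its mean is minus the shortfall from the maximal
    reward.\<close>
  let ?gap = "\<lambda>t s a. max_Q R t s a - max_value R t s"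
  have rew: "reward R Q = initial_mean (max_value R 0) + total_mean Q ?gap" for Q
    unfolding initial_mean_def max_Q_def backup_def by (rule expected_sum_telescope) simp
  have gap: "?gap t s a \<le> 0" if "t < T" "a \<in> Act t" for t s a
    using max_Q_le_max_value[OF that] by simp
  have "total_mean P ?gap \<le> total_mean P (\<lambda>t s a. 0)"
    using P by (intro expected_sum_mono gap) (auto simp: positive_policy_def)
  then have "total_mean P ?gap \<le> 0"
    by (simp add: expected_sum_const)
  then consider "total_mean P ?gap = 0" | "total_mean P ?gap < 0"
    by linarith
  then show ?thesis
  proof cases
    case 1
    have gap_0: "?gap t s a = 0" if t: "t < T" and s: "s \<in> set_pmf (state_law p0 p P t)" and a: "a \<in> Act t" for t s a
    proof -
      have le: "pmf (P t s) a * ?gap t s a \<le> 0" if "t < T" for t s a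
      proof (cases "a \<in> Act t")
        case False
        then have "pmf (P t s) a = 0"
          using P that by (simp add: positive_policy_def pmf_eq_0_set_pmf)
        then show ?thesis
          by simp
      qed (use gap[OF that] in \<open>simp add: mult_nonneg_nonpos\<close>)
      have "(\<Sum>a\<in>UNIV. pmf (P t s) a * ?gap t s a) = 0"
        using 1 t s by (intro expected_sum_nonpos_eq_0[where T = T and f = ?gap]) (auto intro!: sum_nonpos le)
      then have "(\<Sum>a\<in>UNIV. - (pmf (P t s) a * ?gap t s a)) = 0"
        by (simp add: sum_negf)
      then have "\<forall>a\<in>UNIV. - (pmf (P t s) a * ?gap t s a) = 0"
        using le[OF t] by (subst (asm) sum_nonneg_eq_0_iff) auto
      then have "pmf (P t s) a * ?gap t s a = 0"
        by simp
      moreover have "a \<in> set_pmf (P t s)"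
        using P t a by (auto simp: positive_policy_def)
      ultimately show ?thesis
        by (auto simp: set_pmf_iff)
    qed
    \<comment> \<open>The multiplier 0 is an arbitrary choice: every softmax policy has the same
      action supports as \<open>P\<close>, hence visits only states that \<open>P\<close>
      reaches.\<close>
    have reach: "set_pmf (state_law p0 p (?pi 0) t) \<subseteq> set_pmf (state_law p0 p P t)" if "t < T" for t
      using P that by (intro set_state_law_mono) (auto simp: positive_policy_def set_soft_policy)
    have "total_mean (?pi 0) ?gap = total_mean (?pi 0) (\<lambda>t s a. 0)"
    proof (rule expected_sum_cong)
      fix t s a assume "t < T" "s \<in> set_pmf (state_law p0 p (?pi 0) t)" "a \<in> set_pmf (?pi 0 t s)"
      then show "?gap t s a = 0"
        using reach[of t] by (intro gap_0) (auto simp: set_soft_policy)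
    qed
    then have "total_mean (?pi 0) ?gap = 0"
      by (simp add: expected_sum_const)
    then show ?thesis
      using rew[of P] rew[of "?pi 0"] 1 by (intro exI[of _ 0]) linarith
  next
    case 2
    obtain C where C: "C > 0" "\<And>P. entropy P \<le> C"
      using entropy_bounded by blast
    \<comment> \<open>\<open>d\<close> is the shortfall of \<open>P\<close> from the maximal reward.
      With \<open>lam = C / d\<close> the entropy contributes at most \<open>lam * d\<close>, and
      dividing by \<open>lam\<close> bounds the shortfall of the softmax policy by
      \<open>d\<close>.\<close>
    define d where "d = - total_mean P ?gap"
    define lam where "lam = C / d"
    have "d > 0"
      using 2 by (simp add: d_def)
    then have "lam > 0"
      using C(1) by (simp add: lam_def)
    have "lam * initial_mean (max_value R 0) \<le> initial_mean (soft_value (\<lambda>s a. lam * R s a) 0)"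
      unfolding initial_mean_def sum_distrib_left mult.left_commute[of lam]
      using \<open>lam > 0\<close> by (intro sum_mono mult_left_mono max_value_le_soft_value) auto
    also have "\<dots> = lam * reward R (?pi lam) + entropy (?pi lam)"
      by (simp add: reward_plus_entropy_soft_policy[symmetric] expected_sum_cmult)
    also have "\<dots> \<le> lam * reward R (?pi lam) + C"
      using C by simp
    also have "C = lam * d"
      using \<open>d > 0\<close> by (simp add: lam_def)
    finally have "lam * (initial_mean (max_value R 0) - d) \<le> lam * reward R (?pi lam)"
      by (simp add: algebra_simps)
    then have "initial_mean (max_value R 0) - d \<le> reward R (?pi lam)"
      using \<open>lam > 0\<close> by simp
    then show ?thesis
      using rew[of P] by (intro exI[of _ lam]) (simp add: d_def)
  qed
qed

text \<open>Negating the reward turns the lower bound into an upper one; the sign moves into the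
  multiplier.\<close>

lemma soft_policy_reward_le:
  assumes "positive_policy P"
  shows "\<exists>lam. reward R (soft_policy (\<lambda>s a. lam * R s a)) \<le> reward R P"
proof -
  have neg: "reward (\<lambda>s a. - R s a) Q = - reward R Q" for Q
    using expected_sum_cmult[of p0 p T Q "-1"] by simp
  obtain lam where "reward (\<lambda>s a. - R s a) P \<le> reward (\<lambda>s a. - R s a) (soft_policy (\<lambda>s a. lam * - R s a))"
    using soft_policy_reward_ge[OF assms] by blast
  then have "reward R (soft_policy (\<lambda>s a. (- lam) * R s a)) \<le> reward R P"
    by (simp add: neg)
  then show ?thesis
    by blast
qed

section \<open>Continuity in the multiplier and intermediate values\<close>

lemma continuous_soft_value:
  "t \<le> T \<Longrightarrow> continuous_on UNIV (\<lambda>lam. soft_value (\<lambda>s a. lam * R s a) t s)"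
proof (induction t arbitrary: s rule: inc_induct)
  case (step t)
  have "continuous_on UNIV (\<lambda>lam. soft_Q (\<lambda>s a. lam * R s a) t s a)" for a
    unfolding soft_Q_def backup_def by (intro continuous_intros step.IH)
  \<comment> \<open>Positivity of the partition sum keeps the logarithm continuous.\<close>
  then show ?case
    using mu_pos[of s] sum_exp_soft_Q_pos[OF step(2)]
    by (simp only: soft_value_step[OF step(2)]) (intro continuous_intros; simp add: less_imp_neq[THEN not_sym])
qed simp

lemma continuous_pmf_soft_policy:
  assumes "t < T"
  shows "continuous_on UNIV (\<lambda>lam. pmf (soft_policy (\<lambda>s a. lam * R s a) t s) a)"
proof (cases "a \<in> Act t")
  case True
  then show ?thesis
    using assms mu_pos[of s]
    by (simp add: pmf_soft_policy soft_Q_def backup_def)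
      (intro continuous_intros continuous_soft_value; simp add: less_imp_neq[THEN not_sym])
qed (simp add: pmf_soft_policy assms)

lemma continuous_state_law:
  "t \<le> T \<Longrightarrow> continuous_on UNIV (\<lambda>lam. pmf (state_law p0 p (soft_policy (\<lambda>s a. lam * R s a)) t) s)"
proof (induction t arbitrary: s)
  case (Suc t)
  then show ?case
    unfolding pmf_state_law_Suc by (intro continuous_intros continuous_pmf_soft_policy) auto
qed simp

lemma continuous_reward:
  "continuous_on UNIV (\<lambda>lam. reward R (soft_policy (\<lambda>s a. lam * R s a)))"
  unfolding expected_sum_def
  by (intro continuous_intros continuous_state_law continuous_pmf_soft_policy) auto

lemma soft_policy_reward_eq:
  assumes "positive_policy P"
  shows "\<exists>lam. reward R (soft_policy (\<lambda>s a. lam * R s a)) = reward R P"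
proof -
  \<comment> \<open>The multipliers \<open>l\<close> and \<open>u\<close> come in no particular
    order, so the intermediate value theorem is used as connectedness of the range.\<close>
  let ?I = "range (\<lambda>lam. reward R (soft_policy (\<lambda>s a. lam * R s a)))"
  have "connected ?I"
    by (intro connected_continuous_image continuous_reward) simp
  moreover obtain l u where "reward R (soft_policy (\<lambda>s a. l * R s a)) \<le> reward R P"
    "reward R P \<le> reward R (soft_policy (\<lambda>s a. u * R s a))"
    using soft_policy_reward_le[OF assms] soft_policy_reward_ge[OF assms] by blast
  ultimately have "reward R P \<in> ?I"
    unfolding connected_iff_interval by blast
  then show ?thesis
    by auto
qed

end

section \<open>Generalized entropy\<close>

text \<open>Integrating \<open>mu s / q\<close> shows that \<open>G\<close> is a power of
  \<open>q\<close> up to a factor. The recursion is insensitive to the constant \<open>c\<close>,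
  but a state-dependent one would enter the entropy through the state marginals;
  \<open>G_one\<close> makes it common to all states.\<close>

lemma G_power_form:
  fixes G :: "real \<Rightarrow> 's \<Rightarrow> real"
  assumes "assumption_A G" and G_one: "\<And>s s'. G 1 s = G 1 s'"
  obtains mu c where "\<And>s. 0 < mu s" "\<And>s q. 0 < q \<Longrightarrow> ln (G q s) = c + mu s * ln q"
    "\<And>s q. 0 < q \<Longrightarrow> 0 < G q s"
proof -
  from assms(1) obtain mu where mu: "\<And>s. 0 < mu s"
    and der: "\<And>s q. 0 < q \<Longrightarrow> ((\<lambda>x. ln (G x s)) has_real_derivative mu s / q) (at q)"
    unfolding assumption_A_def by blast
  \<comment> \<open>\<open>undefined\<close> serves as a reference state; by \<open>G_one\<close>
    any state gives the same constant.\<close>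
  show ?thesis
  proof (rule that[of mu "ln (G 1 undefined)"])
    fix s :: 's and q :: real assume "0 < q"
    have "\<exists>k. \<forall>x\<in>{0<..}. ln (G x s) - mu s * ln x = k"
    proof (rule has_field_derivative_zero_constant)
      fix x :: real assume "x \<in> {0<..}"
      then have "((\<lambda>x. ln (G x s) - mu s * ln x) has_real_derivative mu s / x - mu s * (1 / x)) (at x)"
        by (intro DERIV_diff der DERIV_cmult DERIV_ln_divide) auto
      then show "((\<lambda>x. ln (G x s) - mu s * ln x) has_field_derivative 0) (at x within {0<..})"
        by (simp add: has_field_derivative_at_within)
    qed simp
    then have "ln (G q s) - mu s * ln q = ln (G 1 s) - mu s * ln 1"
      using \<open>0 < q\<close> by (metis greaterThan_iff zero_less_one)
    then show "ln (G q s) = ln (G 1 undefined) + mu s * ln q"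
      by (simp add: G_one[of s undefined])
  qed (use mu assms(1) in \<open>auto simp: assumption_A_def\<close>)
qed

lemma G_inverse_G:
  assumes "assumption_A G" "0 < q"
  shows "G_inverse G (G q s) s = q"
proof -
  have "\<exists>!F. is_G_inverse G F"
    using assms(1) by (simp add: assumption_A_def)
  then have "is_G_inverse G (G_inverse G)"
    unfolding G_inverse_def by (rule theI')
  then show ?thesis
    using assms(2) by (simp add: is_G_inverse_def)
qed

text \<open>The value solves \<open>c + mu s * ln q = y\<close> for \<open>q\<close>, and the left
  inverse is evaluated at the image of this solution under \<open>G\<close>.\<close>

lemma G_inverse_exp:
  assumes A: "assumption_A G" and "0 < mu s" "0 < G (exp ((y - c) / mu s)) s"
    and form: "\<And>q. 0 < q \<Longrightarrow> ln (G q s) = c + mu s * ln q"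
  shows "G_inverse G (exp y) s = exp ((y - c) / mu s)"
proof -
  have "ln (G (exp ((y - c) / mu s)) s) = y"
    using assms(2) by (subst form) auto
  then have "G (exp ((y - c) / mu s)) s = exp y"
    using assms(3) by (metis exp_ln)
  then show ?thesis
    using G_inverse_G[OF A, of "exp ((y - c) / mu s)" s] by simp
qed

text \<open>Action probabilities in states of probability zero influence neither the entropy nor the
  reward, so optimality determines them only in reachable states. \<open>lam\<close> is quantified
  before \<open>P\<close> and hence cannot depend on it.\<close>

theorem theorem1:
  fixes G :: "real \<Rightarrow> 's::finite \<Rightarrow> real"
    and p0 :: "'s pmf"
    and p :: "'a::finite \<Rightarrow> 's \<Rightarrow> 's pmf"
    and R :: "'s \<Rightarrow> 'a \<Rightarrow> real"
    and T :: nat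
    and Act :: "nat \<Rightarrow> 'a set"
  assumes horizon: "1 \<le> T"
    and A: "assumption_A G"
    and G_one: "\<And>s s'. G 1 s = G 1 s'"
  shows "\<exists>lam :: real \<Rightarrow> real. \<forall>r P. gmce_optimal G p0 p R T Act r P \<longrightarrow>
           (\<exists>Y Za Zs. gmce_recursion G p R T Act (lam r) Y Za Zs \<and>
              (\<forall>t<T. \<forall>s. \<forall>a\<in>Act t.
                 measure_pmf.prob (trajectory_law p0 p T P) {w. state_at w t = s} > 0 \<longrightarrow>
                 pmf (P t s) a = Za t s a / Zs t s))"
proof (cases "\<forall>t<T. Act t \<noteq> {}")
  case False
  \<comment> \<open>An empty action set violates normalization, since the empty sum is 0, so nothing
    is feasible.\<close>
  then have "\<not> gmce_optimal G p0 p R T Act r P" for r P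
    by (force simp: gmce_optimal_def gmce_feasible_def)
  then show ?thesis
    by blast
next
  case True
  obtain mu c where mu: "\<And>s. 0 < mu s"
    and lnG: "\<And>s q. 0 < q \<Longrightarrow> ln (G q s) = c + mu s * ln q"
    and G_pos: "\<And>s q. 0 < q \<Longrightarrow> 0 < G q s"
    using G_power_form[OF A G_one] by blast
  interpret soft_control p0 p T Act mu
    using mu True by unfold_locales auto
  let ?q = "\<lambda>l s a. l * R s a"
  have reward: "expected_reward p0 p R T P = reward R P" for P
    unfolding expected_reward_def by (rule expectation_trajectory_law)
  have feasible: "gmce_feasible p0 p R T Act r P \<longleftrightarrow> positive_policy P \<and> reward R P = r" for r P
  proof -
    \<comment> \<open>Normalization over \<open>Act t\<close> leaves no mass outside it, which
      bounds the support from above.\<close>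
    have "set_pmf (P t s) = Act t \<longleftrightarrow> (\<forall>a\<in>Act t. 0 < pmf (P t s) a) \<and> (\<Sum>a\<in>Act t. pmf (P t s) a) = 1"
      for t s
    proof
      assume "(\<forall>a\<in>Act t. 0 < pmf (P t s) a) \<and> (\<Sum>a\<in>Act t. pmf (P t s) a) = 1"
      moreover from this have "measure_pmf.prob (P t s) (Act t) = 1"
        by (simp add: measure_measure_pmf_finite)
      then have "set_pmf (P t s) \<subseteq> Act t"
        by (auto simp: measure_pmf.prob_eq_1 AE_measure_pmf_iff)
      ultimately show "set_pmf (P t s) = Act t"
        by (auto simp: set_pmf_iff)
    qed (auto intro!: sum_pmf_eq_1 pmf_positive)
    then show ?thesis
      unfolding gmce_feasible_def positive_policy_def reward by blast
  qed
  \<comment> \<open>By the power form each of the \<open>T\<close> time steps contributes the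
    constant \<open>- c\<close>.\<close>
  have entropy: "gen_causal_entropy G p0 p T P = entropy P - real T * c" if "positive_policy P" for P
  proof -
    have "gen_causal_entropy G p0 p T P = total_mean P (\<lambda>t s a. - ln (G (pmf (P t s) a) s))"
      unfolding gen_causal_entropy_def sum_negf[symmetric] by (rule expectation_trajectory_law)
    also have "\<dots> = total_mean P (\<lambda>t s a. - mu s * ln (pmf (P t s) a) + - c)"
      by (rule expected_sum_cong) (simp add: lnG pmf_positive)
    also have "\<dots> = entropy P - real T * c"
      unfolding expected_sum_add entropy_def by (simp add: expected_sum_const)
    finally show ?thesis .
  qed
  \<comment> \<open>Chosen from \<open>r\<close> alone. If no softmax policy attains
    \<open>r\<close>, the value is arbitrary, but then no policy is feasible for \<open>r\<close>
    either.\<close>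
  define lam where "lam r = (SOME l. reward R (soft_policy (?q l)) = r)" for r
  show ?thesis
  proof (intro exI[of _ lam] allI impI)
    fix r P assume opt: "gmce_optimal G p0 p R T Act r P"
    then have P: "positive_policy P" "reward R P = r"
      by (auto simp: gmce_optimal_def feasible)
    let ?l = "lam r"
    have lam: "reward R (soft_policy (?q ?l)) = r"
      unfolding lam_def using soft_policy_reward_eq[OF P(1), of R] P(2) by (metis (mono_tags) someI_ex)
    \<comment> \<open>The softmax policy is feasible for \<open>r\<close>, and the constant
      \<open>real T * c\<close> cancels in the comparison.\<close>
    then have ent: "entropy (soft_policy (?q ?l)) \<le> entropy P"
      using opt positive_soft_policy[of "?q ?l"] P
      by (auto simp: gmce_optimal_def feasible entropy)
    define V where "V = soft_value (?q ?l)"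
    define Y where "Y = soft_Q (?q ?l)"
    \<comment> \<open>The closed form of \<open>G_inverse\<close> at
      \<open>exp (Y t s a)\<close>.\<close>
    define Za where "Za = (\<lambda>(t::nat) s a. exp ((Y t s a - c) / mu s))"
    define Zs where "Zs t s = (\<Sum>a\<in>Act t. Za t s a)" for t s
    have Zs: "Zs t s = exp ((V t s - c) / mu s)" if "t < T" for t s
      using sum_exp_soft_Q[OF that, of "?q ?l" s]
      by (simp add: Zs_def Za_def Y_def V_def diff_divide_distrib exp_diff flip: sum_divide_distrib)
    \<comment> \<open>The shift by \<open>c\<close> in \<open>Zs\<close> cancels against the one in
      \<open>ln (G q s)\<close>, so the recursion reproduces the soft value.\<close>
    have lnG_Zs: "ln (G (Zs t s) s) = V t s" if "t < T" for t s
      using mu[of s] by (simp add: Zs that lnG)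
    have "gmce_recursion G p R T Act ?l Y Za Zs"
      unfolding gmce_recursion_def
    proof (intro conjI allI impI ballI)
      fix t s a assume "t < T" "a \<in> Act t"
      have "Y t s a = ?l * R s a + (\<Sum>s'\<in>UNIV. pmf (p a s) s' * V (Suc t) s')"
        by (simp add: Y_def V_def soft_Q_def backup_def)
      \<comment> \<open>The zero expectation term at the last step agrees with the terminal value of
        \<open>V\<close> at time \<open>T\<close>.\<close>
      moreover have "V (Suc t) s' = 0" if "\<not> Suc t < T" for s'
      proof -
        have "Suc t = T"
          using that \<open>t < T\<close> by simp
        then show ?thesis
          by (simp add: V_def)
      qed
      ultimately show "Y t s a = ?l * R s a + (if Suc t < T
          then measure_pmf.expectation (p a s) (\<lambda>s'. ln (G (Zs (Suc t) s') s')) else 0)"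
        by (simp add: integral_measure_pmf_real[of UNIV] lnG_Zs mult.commute)
    next
      fix t s a
      show "Za t s a = G_inverse G (exp (Y t s a)) s"
        unfolding Za_def by (rule G_inverse_exp[OF A mu _ lnG, symmetric]) (auto intro: G_pos)
    qed (simp add: Zs_def)
    moreover have "pmf (P t s) a = Za t s a / Zs t s"
      if "t < T" "a \<in> Act t"
        "measure_pmf.prob (trajectory_law p0 p T P) {w. state_at w t = s} > 0" for t s a
    proof -
      have "s \<in> set_pmf (state_law p0 p P t)"
        using that by (simp add: prob_state_at set_pmf_iff)
      then have "pmf (P t s) a = pmf (soft_policy (?q ?l) t s) a"
        using that P lam ent by (intro entropy_le_imp_soft_policy) auto
      \<comment> \<open>The factors \<open>exp (- c / mu s)\<close> in numerator and denominator
        cancel.\<close>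
      also have "\<dots> = Za t s a / Zs t s"
        using that by (simp add: pmf_soft_policy Zs Za_def Y_def V_def diff_divide_distrib exp_diff)
      finally show ?thesis .
    qed
    ultimately show "\<exists>Y Za Zs. gmce_recursion G p R T Act ?l Y Za Zs \<and>
        (\<forall>t<T. \<forall>s. \<forall>a\<in>Act t.
           measure_pmf.prob (trajectory_law p0 p T P) {w. state_at w t = s} > 0 \<longrightarrow>
           pmf (P t s) a = Za t s a / Zs t s)"
      by blast
  qed
qed

end
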